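(* Let $d\ge 1$, let $B$ be a branching function without extinction, and let $(\mathbb{V},\mathbb{A})$ be the rooted tree defined by $B$, with upper growth rate $\overline{\mathsf{gr}}(\mathbb{V})$. Let $\mu$ be a probability measure on $G=\mathsf{GL}(d,\mathbb{R})$ satisfying Conditions 1 (integrability), 2 (strong irreducibility) and 3 (strict positivity) stated in the context, and let $\lambda=\inf_{s\in[0,1]}k(s)$. Let $(\xi_a)_{a\in\mathbb{A}}$ be independent $G$-valued random variables with common law $\mu$, and let $\zeta_\infty$ be the limit of the integrated matrix-multiplicative cascade process built from them. If $$\lambda\,\overline{\mathsf{gr}}(\mathbb{V})<1,$$ then, almost surely, $\zeta_{\infty,ij}<\infty$ for all $i,j=1,\ldots,d$.
   Context: **Trees.** $\mathbb{N}=\{1,2,3,\ldots\}$, $\mathbb{Z}_+=\{0,1,2,\ldots\}$, $\mathbb{N}_n=\{1,\ldots,n\}$ for $n\ge1$, and $\mathbb{N}_0=\emptyset$. $\mathbb{N}^*$ denotes the set of finite words (including the empty word $\emptyset$) on the alphabet $\mathbb{N}$; $|\mathbf{v}|$ is the length of the word $\mathbf{v}$, and $\mathbf{v}{\upharpoonright}_n$ is the word formed by its first $n$ letters. For $|\mathbf v|\ge1$ the ancestor of $\mathbf{v}$ is $\hat{\mathbf{v}}=\mathbf{v}{\upharpoonright}_{|\mathbf{v}|-1}$. A branching function is a map $B:\mathbb{N}^*\to\mathbb{Z}_+$. It defines a rooted tree with vertex set $\mathbb{V}=\bigcup_{n\ge0}\mathbb{V}^n$, where $\mathbb{V}^0=\{\emptyset\}$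 (the root) and, for $n\ge1$, $\mathbb{V}^n=\{v_1\cdots v_n: v_l\in\mathbb{N}_{B(v_1\cdots v_{l-1})},\ l=1,\ldots,n\}$. The edge set $\mathbb{A}$ consists of the edges $a(\mathbf{v})=[\hat{\mathbf{v}},\mathbf{v}]$, $\mathbf{v}\in\mathbb{V}\setminus\{\emptyset\}$. The boundary $\partial\mathbb{V}$ is the set of infinite words all of whose finite prefixes lie in $\mathbb{V}$; $B$ is without extinction if $\partial\mathbb{V}$ is non-trivial (non-empty). With $\kappa_n=\operatorname{card}\mathbb{V}^n$, the upper growth rate is $\overline{\mathsf{gr}}(\mathbb{V})=\limsup_n\kappa_n^{1/n}$. **Cascade.** For $\mathbf{v}\in\mathbb{V}$ with $|\mathbf{v}|=n\ge1$, let $a_1,\ldots,a_n$ be the successive edges of the path from the root to $\mathbf{v}$, and put $\xi[\mathbf{v}]=\xi_{a_n}\cdots\xi_{a_1}$. For $n\ge1$, $\psi_n=\sum_{\mathbf{v}\in\mathbb{V}^n}\xi[\mathbf{v}]$ and $\zeta_n=\sum_{k=1}^n\psi_k$. Under Condition 3 the entries are almost surely nonnegative, and $\zeta_\infty=\lim_n\zeta_n$ entrywise, with entries $\zeta_{\infty,ij}\in[0,\infty]$. **Conditions on $\mu$.** $\|\cdot\|$ is the operator norm on $d\times d$ matrices induced by the $\ell_1$ norm of $\mathbb{R}^d$. $\sigma_\mu$ is the support of $\mu$ in $G$ and $\Sigma_\mu$ the semigroup generated by $\sigma_\mu$. $G_+$ is the set of elements of $G$ with all entries strictly positive, $\overline{G}_+$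 the set of those with all entries nonnegative. - Condition 1: $\int_G\|g\|^s\mu(dg)<\infty$ for all $s\in[0,\infty)$. - Condition 2: there is no finite $\Sigma_\mu$-invariant family of proper (non-zero) linear subspaces of $\mathbb{R}^d$. - Condition 3: $\sigma_\mu\subseteq\overline{G}_+$ and $\mu(\overline{G}_+\setminus G_+)=0$. **The parameter.** For $s\ge0$, $k(s)=\lim_n\left(\int_G\|g\|^s\mu^{\star n}(dg)\right)^{1/n}$, where $\mu^{\star n}$ is the $n$-fold convolution of $\mu$ (the law of a product of $n$ independent random matrices of law $\mu$). Under Conditions 1–3 this limit exists in $[0,\infty)$. *)

theory Defs
  imports "HOL-Probability.Probability"
begin

section \<open>Trees defined by branching functions\<close>

text \<open>Words on the alphabet \<open>{1, 2, \<dots>}\<close> are lists of naturals. A branching function is any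
  \<open>B :: nat list \<Rightarrow> nat\<close>; its values on lists containing the letter 0 are never used.\<close>

definition tree_level :: "(nat list \<Rightarrow> nat) \<Rightarrow> nat \<Rightarrow> nat list set" where
  "tree_level B n = {v. length v = n \<and> (\<forall>l<n. v ! l \<in> {1..B (take l v)})}"

definition tree_vertices :: "(nat list \<Rightarrow> nat) \<Rightarrow> nat list set" where
  "tree_vertices B = (\<Union>n. tree_level B n)"

definition tree_edges :: "(nat list \<Rightarrow> nat) \<Rightarrow> (nat list \<times> nat list) set" where
  "tree_edges B = {(butlast v, v) |v. v \<in> tree_vertices B - {[]}}"

definition tree_boundary :: "(nat list \<Rightarrow> nat) \<Rightarrow> (nat \<Rightarrow> nat) set" where
  "tree_boundary B = {w. \<forall>n. map w [0..<n] \<in> tree_vertices B}"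

definition without_extinction :: "(nat list \<Rightarrow> nat) \<Rightarrow> bool" where
  "without_extinction B \<longleftrightarrow> tree_boundary B \<noteq> {}"

text \<open>The values \<open>B v\<close> need not be bounded, so the upper growth rate may be infinite.\<close>

definition upper_growth_rate :: "(nat list \<Rightarrow> nat) \<Rightarrow> ereal" where
  "upper_growth_rate B = limsup (\<lambda>n. ereal (root n (real (card (tree_level B n)))))"


section \<open>Probability measures on the general linear group\<close>

definition GL :: "(real^'n^'n) set" where
  "GL = {g. invertible g}"

definition GL_borel :: "(real^'n^'n) measure" where
  "GL_borel = restrict_space borel GL"

definition l1_norm :: "real^'n \<Rightarrow> real" where
  "l1_norm x = (\<Sum>i\<in>UNIV. \<bar>x $ i\<bar>)"

text \<open>As in the library's \<^const>\<open>onorm\<close>, the term at \<open>x = 0\<close> is \<open>0 / 0 = 0\<close>.\<close>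

definition l1_opnorm :: "real^'n^'n \<Rightarrow> real" where
  "l1_opnorm g = (SUP x. l1_norm (g *v x) / l1_norm x)"

definition GL_support :: "(real^'n^'n) measure \<Rightarrow> (real^'n^'n) set" where
  "GL_support \<mu> = {g \<in> GL. \<forall>U. open U \<and> g \<in> U \<longrightarrow> emeasure \<mu> (U \<inter> GL) > 0}"

inductive_set generated_semigroup :: "(real^'n^'n) set \<Rightarrow> (real^'n^'n) set"
  for S :: "(real^'n^'n) set" where
  base: "g \<in> S \<Longrightarrow> g \<in> generated_semigroup S"
| mult: "g \<in> generated_semigroup S \<Longrightarrow> h \<in> generated_semigroup S \<Longrightarrow>
    g ** h \<in> generated_semigroup S"

definition GL_pos :: "(real^'n^'n) set" where
  "GL_pos = {g \<in> GL. \<forall>i j. g $ i $ j > 0}"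

definition GL_nonneg :: "(real^'n^'n) set" where
  "GL_nonneg = {g \<in> GL. \<forall>i j. g $ i $ j \<ge> 0}"

definition all_moments :: "(real^'n^'n) measure \<Rightarrow> bool" where
  "all_moments \<mu> \<longleftrightarrow> (\<forall>s\<ge>0. integrable \<mu> (\<lambda>g. l1_opnorm g powr s))"

definition strongly_irreducible :: "(real^'n^'n) measure \<Rightarrow> bool" where
  "strongly_irreducible \<mu> \<longleftrightarrow>
    \<not> (\<exists>F :: (real^'n) set set. finite F \<and> F \<noteq> {} \<and>
        (\<forall>W\<in>F. subspace W \<and> W \<noteq> {0} \<and> W \<noteq> UNIV) \<and>
        (\<forall>g\<in>generated_semigroup (GL_support \<mu>). \<forall>W\<in>F. (\<lambda>x. g *v x) ` W \<in> F))"

definition strictly_positive :: "(real^'n^'n) measure \<Rightarrow> bool" where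
  "strictly_positive \<mu> \<longleftrightarrow>
    GL_support \<mu> \<subseteq> GL_nonneg \<and> GL_nonneg - GL_pos \<in> null_sets \<mu>"

text \<open>Multiplicative convolution; the library's \<^const>\<open>convolution\<close> is the additive one.\<close>

definition mult_convolution ::
    "(real^'n^'n) measure \<Rightarrow> (real^'n^'n) measure \<Rightarrow> (real^'n^'n) measure" where
  "mult_convolution \<mu> \<nu> = distr (\<mu> \<Otimes>\<^sub>M \<nu>) GL_borel (\<lambda>(g, h). g ** h)"

primrec conv_power :: "(real^'n^'n) measure \<Rightarrow> nat \<Rightarrow> (real^'n^'n) measure" where
  "conv_power \<mu> 0 = return GL_borel (mat 1)"
| "conv_power \<mu> (Suc n) = mult_convolution \<mu> (conv_power \<mu> n)"

definition k_fun :: "(real^'n^'n) measure \<Rightarrow> real \<Rightarrow> real" where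
  "k_fun \<mu> s = lim (\<lambda>n. root n (\<integral>g. l1_opnorm g powr s \<partial>conv_power \<mu> n))"


section \<open>The integrated matrix-multiplicative cascade\<close>

definition path_edges :: "nat list \<Rightarrow> (nat list \<times> nat list) list" where
  "path_edges v = map (\<lambda>l. (take l v, take (Suc l) v)) [0..<length v]"

text \<open>If \<open>path_edges v = [a\<^sub>1, \<dots>, a\<^sub>n]\<close>, the following is \<open>\<xi> a\<^sub>n ** \<dots> ** \<xi> a\<^sub>1\<close>.\<close>

definition path_product ::
    "(nat list \<times> nat list \<Rightarrow> 'w \<Rightarrow> real^'n^'n) \<Rightarrow> nat list \<Rightarrow> 'w \<Rightarrow> real^'n^'n" where
  "path_product \<xi> v \<omega> = fold (\<lambda>a P. \<xi> a \<omega> ** P) (path_edges v) (mat 1)"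

definition cascade_psi ::
    "(nat list \<Rightarrow> nat) \<Rightarrow> (nat list \<times> nat list \<Rightarrow> 'w \<Rightarrow> real^'n^'n) \<Rightarrow>
      nat \<Rightarrow> 'w \<Rightarrow> real^'n^'n" where
  "cascade_psi B \<xi> n \<omega> = (\<Sum>v\<in>tree_level B n. path_product \<xi> v \<omega>)"

definition cascade_zeta ::
    "(nat list \<Rightarrow> nat) \<Rightarrow> (nat list \<times> nat list \<Rightarrow> 'w \<Rightarrow> real^'n^'n) \<Rightarrow>
      nat \<Rightarrow> 'w \<Rightarrow> real^'n^'n" where
  "cascade_zeta B \<xi> n \<omega> = (\<Sum>k=1..n. cascade_psi B \<xi> k \<omega>)"

text \<open>The entrywise limit is taken in the extended reals. Under strict positivity of the common
  law the partial sums are almost surely nondecreasing, so it exists in \<open>[0, \<infinity>]\<close>; on the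
  exceptional null event its value is irrelevant.\<close>

definition cascade_zeta_inf ::
    "(nat list \<Rightarrow> nat) \<Rightarrow> (nat list \<times> nat list \<Rightarrow> 'w \<Rightarrow> real^'n^'n) \<Rightarrow>
      'n \<Rightarrow> 'n \<Rightarrow> 'w \<Rightarrow> ereal" where
  "cascade_zeta_inf B \<xi> i j \<omega> = lim (\<lambda>n. ereal (cascade_zeta B \<xi> n \<omega> $ i $ j))"

end

theory Submission
  imports Defs
begin

text \<open>
The idea is a fractional first-moment bound. Fix an exponent \<open>s \<in> (0, 1]\<close> and write \<open>\<kappa>\<^sub>n\<close> for the
number of vertices at level \<open>n\<close>. For a vertex \<open>v\<close> at that level the product \<open>\<xi>[v]\<close> of \<open>n\<close>
independent matrices has law \<open>\<mu>\<^sup>\<star>\<^sup>n\<close> (\<open>distr_fold_mult\<close>), so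
\<open>E (\<Sum>\<^sub>v \<parallel>\<xi>[v]\<parallel>\<^sup>s) = \<kappa>\<^sub>n * a\<^sub>n\<close>, where \<open>a\<^sub>n\<close> is the \<open>s\<close>-th moment of the norm under \<open>\<mu>\<^sup>\<star>\<^sup>n\<close>. The
\<open>n\<close>-th root of this expectation has limit superior \<open>k(s)\<close> times the upper growth rate. If that
number is below 1, the expectations are summable (\<open>summable_mult_if_growth\<close>), and the series of the
level sums \<open>\<Sum>\<^sub>v \<parallel>\<xi>[v]\<parallel>\<^sup>s\<close> converges almost surely (\<open>AE_summable_if_mean_summable\<close>). In particular
the level sums tend to 0, so far down the tree all norms are at most 1 and satisfy
\<open>\<parallel>\<xi>[v]\<parallel> \<le> \<parallel>\<xi>[v]\<parallel>\<^sup>s\<close>. Hence the series of the norms themselves converges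
(\<open>summable_sum_if_summable_sum_powr\<close>), and with it every entry of the integrated cascade.

Three points need care. The number \<open>k(s)\<close> must be an actual limit; this is Fekete's lemma for the
submultiplicative moments (\<open>submultiplicative_root_tendsto_INF\<close>, \<open>k_fun_limit\<close>). The exponent \<open>s\<close> must
be positive; this is automatic, because \<open>k(0) = 1\<close> and a tree without extinction has upper growth
rate at least 1. Finally, the infimum of \<open>k\<close> must be positive, since otherwise an infinite growth rate
would be compatible with the hypothesis \<open>\<lambda> * gr < 1\<close> in the extended reals. This follows from the
determinant: it is multiplicative and, up to a constant, bounded by the \<open>d\<close>-th power of the norm, so
the \<open>s\<close>-th moments of the norm decay at most like the powers of \<open>E \<bar>det g\<bar>\<^sup>s\<^sup>/\<^sup>d\<close>, and the latter mean is
bounded below by \<open>E (min 1 \<bar>det g\<bar>) > 0\<close>, uniformly in \<open>s \<in> [0, 1]\<close> (\<open>truncated_det_mean_le_k_fun\<close>).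
\<close>

section \<open>The operator norm and the determinant\<close>

lemma column_sum_le:
  fixes g :: "real^'n^'n"
  shows "(\<Sum>i\<in>UNIV. \<bar>g $ i $ j\<bar>) \<le> (MAX j. \<Sum>i\<in>UNIV. \<bar>g $ i $ j\<bar>)"
  by (rule Max_ge) auto

lemma l1_norm_mult_le_column_sum:
  fixes g :: "real^'n^'n"
  shows "l1_norm (g *v x) \<le> (MAX j. \<Sum>i\<in>UNIV. \<bar>g $ i $ j\<bar>) * l1_norm x"
proof -
  let ?C = "MAX j. \<Sum>i\<in>UNIV. \<bar>g $ i $ j\<bar>"
  have "l1_norm (g *v x) \<le> (\<Sum>i\<in>UNIV. \<Sum>j\<in>UNIV. \<bar>g $ i $ j\<bar> * \<bar>x $ j\<bar>)"
    unfolding l1_norm_def matrix_vector_mult_def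
    by (auto intro!: sum_mono order_trans[OF sum_abs] simp: abs_mult)
  also have "\<dots> = (\<Sum>j\<in>UNIV. (\<Sum>i\<in>UNIV. \<bar>g $ i $ j\<bar>) * \<bar>x $ j\<bar>)"
    by (subst sum.swap) (simp add: sum_distrib_right)
  also have "\<dots> \<le> (\<Sum>j\<in>UNIV. ?C * \<bar>x $ j\<bar>)"
    by (intro sum_mono mult_right_mono column_sum_le) simp
  also have "\<dots> = ?C * l1_norm x"
    by (simp add: l1_norm_def sum_distrib_left)
  finally show ?thesis .
qed

lemma l1_norm_nonneg: "l1_norm x \<ge> 0"
  by (simp add: l1_norm_def sum_nonneg)

lemma l1_norm_eq_0_iff: "l1_norm x = 0 \<longleftrightarrow> x = 0"
  by (auto simp: l1_norm_def sum_nonneg_eq_0_iff vec_eq_iff)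

text \<open>The column sums are the \<open>\<ell>\<^sub>1\<close> norms of the images of the standard basis vectors, so the supremum
is attained at one of these. The formula makes the norm visibly Borel measurable and bounds every
entry.\<close>

lemma l1_opnorm_eq_Max_column_sum:
  fixes g :: "real^'n^'n"
  shows "l1_opnorm g = (MAX j. \<Sum>i\<in>UNIV. \<bar>g $ i $ j\<bar>)"
proof -
  let ?C = "MAX j. \<Sum>i\<in>UNIV. \<bar>g $ i $ j\<bar>"
  have C0: "?C \<ge> 0"
    by (rule order_trans[OF _ column_sum_le[of g undefined]]) (simp add: sum_nonneg)
  have le: "l1_norm (g *v x) / l1_norm x \<le> ?C" for x
  proof (cases "x = 0")
    case True
    then show ?thesis using C0 by (simp add: l1_norm_def)
  next
    case False
    then have "l1_norm x > 0"
      using l1_norm_nonneg[of x] l1_norm_eq_0_iff[of x] by linarith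
    then show ?thesis
      using l1_norm_mult_le_column_sum[of g x] by (simp add: divide_le_eq)
  qed
  have "?C \<in> range (\<lambda>j. \<Sum>i\<in>UNIV. \<bar>g $ i $ j\<bar>)"
    by (rule Max_in) auto
  then obtain j where j: "?C = (\<Sum>i\<in>UNIV. \<bar>g $ i $ j\<bar>)" by (rule imageE)
  have 1: "l1_norm (axis j 1 :: real^'n) = 1"
    unfolding l1_norm_def axis_def by (simp add: if_distrib cong: if_cong)
  have 2: "l1_norm (g *v axis j 1) = ?C"
    unfolding j l1_norm_def by (simp add: matrix_vector_mul_component inner_axis)
  show ?thesis
    unfolding l1_opnorm_def
  proof (rule antisym)
    show "(SUP x. l1_norm (g *v x) / l1_norm x) \<le> ?C"
      by (rule cSUP_least) (auto intro: le)
    have "l1_norm (g *v axis j 1) / l1_norm (axis j 1 :: real^'n) \<le> (SUP x. l1_norm (g *v x) / l1_norm x)"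
      by (rule cSUP_upper) (auto intro!: bdd_aboveI2 le)
    then show "?C \<le> (SUP x. l1_norm (g *v x) / l1_norm x)"
      using 1 2 by simp
  qed
qed

lemma abs_entry_le_l1_opnorm: "\<bar>g $ i $ j\<bar> \<le> l1_opnorm g"
proof -
  have "\<bar>g $ i $ j\<bar> \<le> (\<Sum>i\<in>UNIV. \<bar>g $ i $ j\<bar>)"
    by (rule member_le_sum) auto
  also have "\<dots> \<le> l1_opnorm g"
    unfolding l1_opnorm_eq_Max_column_sum by (rule column_sum_le)
  finally show ?thesis .
qed

lemma l1_opnorm_nonneg: "l1_opnorm g \<ge> 0"
  using abs_entry_le_l1_opnorm[of g undefined undefined] by linarith

lemma l1_opnorm_mult_le: "l1_opnorm (g ** h) \<le> l1_opnorm g * l1_opnorm h"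
  unfolding l1_opnorm_def[of "g ** h"]
proof (rule cSUP_least)
  fix x :: "real^'a"
  have "l1_norm ((g ** h) *v x) \<le> l1_opnorm g * l1_norm (h *v x)"
    using l1_norm_mult_le_column_sum[of g "h *v x"]
    by (simp add: l1_opnorm_eq_Max_column_sum matrix_vector_mul_assoc)
  also have "\<dots> \<le> l1_opnorm g * (l1_opnorm h * l1_norm x)"
    using l1_norm_mult_le_column_sum[of h x]
    by (intro mult_left_mono l1_opnorm_nonneg) (simp add: l1_opnorm_eq_Max_column_sum)
  finally have *: "l1_norm ((g ** h) *v x) \<le> l1_opnorm g * l1_opnorm h * l1_norm x" by simp
  show "l1_norm ((g ** h) *v x) / l1_norm x \<le> l1_opnorm g * l1_opnorm h"
  proof (cases "x = 0")
    case True
    then show ?thesis by (simp add: l1_norm_def l1_opnorm_nonneg)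
  next
    case False
    then have "l1_norm x > 0"
      using l1_norm_nonneg[of x] l1_norm_eq_0_iff[of x] by linarith
    then show ?thesis using * by (simp add: divide_le_eq)
  qed
qed simp

lemma l1_opnorm_pos:
  fixes g :: "real^'n^'n"
  assumes "g \<in> GL"
  shows "l1_opnorm g > 0"
proof (rule ccontr)
  assume "\<not> l1_opnorm g > 0"
  then have "\<bar>g $ i $ j\<bar> \<le> 0" for i j
    using abs_entry_le_l1_opnorm[of g i j] by linarith
  then have "g = 0"
    by (simp add: vec_eq_iff)
  then have "(mat 1 :: real^'n^'n) = 0"
    using assms by (auto simp: GL_def invertible_def)
  then have "(mat 1 :: real^'n^'n) $ undefined $ undefined = 0"
    by simp
  then show False
    by (simp add: mat_def)
qed

text \<open>Each of the \<open>d!\<close> products in the Leibniz expansion has \<open>d\<close> factors, all bounded by the norm. As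
the determinant is multiplicative, this turns it into a lower bound for norms of long products.\<close>

lemma abs_det_le: "\<bar>det (g :: real^'n^'n)\<bar> \<le> fact CARD('n) * l1_opnorm g ^ CARD('n)"
proof -
  have "\<bar>det g\<bar> \<le> (\<Sum>p | p permutes (UNIV :: 'n set). \<bar>of_int (sign p) * (\<Prod>i\<in>UNIV. g $ i $ p i)\<bar>)"
    unfolding det_def by (rule sum_abs)
  also have "\<dots> \<le> (\<Sum>p | p permutes (UNIV :: 'n set). l1_opnorm g ^ CARD('n))"
  proof (rule sum_mono)
    fix p :: "'n \<Rightarrow> 'n"
    have "\<bar>of_int (sign p) * (\<Prod>i\<in>UNIV. g $ i $ p i)\<bar> = (\<Prod>i\<in>UNIV. \<bar>g $ i $ p i\<bar>)"
      by (simp add: abs_mult abs_prod sign_def)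
    also have "\<dots> \<le> (\<Prod>i\<in>(UNIV::'n set). l1_opnorm g)"
      by (intro prod_mono) (auto intro: abs_entry_le_l1_opnorm)
    finally show "\<bar>of_int (sign p) * (\<Prod>i\<in>UNIV. g $ i $ p i)\<bar> \<le> l1_opnorm g ^ CARD('n)"
      by simp
  qed
  also have "\<dots> = fact CARD('n) * l1_opnorm g ^ CARD('n)"
    by (simp add: card_permutations)
  finally show ?thesis .
qed


section \<open>Measurability on the general linear group\<close>

lemma borel_measurable_det [measurable]: "(det :: real^'n^'n \<Rightarrow> real) \<in> borel_measurable borel"
  unfolding det_def[abs_def]
  by (intro borel_measurable_continuous_onI continuous_intros)

lemma borel_measurable_l1_opnorm [measurable]: "(l1_opnorm :: real^'n^'n \<Rightarrow> real) \<in> borel_measurable borel"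
  unfolding l1_opnorm_eq_Max_column_sum[abs_def]
  by (intro borel_measurable_Max borel_measurable_continuous_onI continuous_intros) auto

lemma borel_measurable_GL_borel:
  "f \<in> borel_measurable borel \<Longrightarrow> f \<in> borel_measurable GL_borel"
  unfolding GL_borel_def by (rule measurable_restrict_space1)

lemma borel_measurable_matrix_mult:
  "(\<lambda>(g, h). g ** h :: real^'n^'n) \<in> borel \<Otimes>\<^sub>M borel \<rightarrow>\<^sub>M borel"
  unfolding borel_prod matrix_matrix_mult_def[abs_def] case_prod_beta
  by (intro borel_measurable_continuous_onI continuous_intros)

lemma space_GL_borel [simp]: "space GL_borel = GL"
  by (simp add: GL_borel_def space_restrict_space)

lemma mult_in_GL: "g \<in> GL \<Longrightarrow> h \<in> GL \<Longrightarrow> g ** h \<in> GL"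
  by (simp add: GL_def invertible_mult)

lemma mat_1_in_GL: "mat 1 \<in> GL"
  unfolding GL_def invertible_def by (auto intro!: exI[of _ "mat 1"])

lemma measurable_GL_borel_iff:
  "f \<in> M \<rightarrow>\<^sub>M GL_borel \<longleftrightarrow> f \<in> space M \<rightarrow> GL \<and> f \<in> M \<rightarrow>\<^sub>M borel"
  by (simp add: GL_borel_def measurable_restrict_space2_iff Pi_iff conj_commute)

lemma measurable_GL_mult [measurable]:
  assumes [measurable]: "f \<in> M \<rightarrow>\<^sub>M GL_borel" "g \<in> M \<rightarrow>\<^sub>M GL_borel"
  shows "(\<lambda>x. f x ** g x :: real^'n^'n) \<in> M \<rightarrow>\<^sub>M GL_borel"
proof -
  have "f \<in> M \<rightarrow>\<^sub>M borel" "g \<in> M \<rightarrow>\<^sub>M borel" "f \<in> space M \<rightarrow> GL" "g \<in> space M \<rightarrow> GL"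
    using assms by (simp_all add: measurable_GL_borel_iff)
  moreover from this have "(\<lambda>x. (\<lambda>(g, h). g ** h) (f x, g x)) \<in> M \<rightarrow>\<^sub>M borel"
    by (intro measurable_compose[OF _ borel_measurable_matrix_mult] measurable_Pair)
  ultimately show ?thesis
    by (auto simp: measurable_GL_borel_iff intro: mult_in_GL)
qed

section \<open>Roots of submultiplicative sequences\<close>

lemma submultiplicative_power_le:
  fixes a :: "nat \<Rightarrow> real"
  assumes "\<And>n. a n \<ge> 0" "\<And>m n. a (m + n) \<le> a m * a n"
  shows "a (q * m + r) \<le> a m ^ q * a r"
proof (induction q)
  case (Suc q)
  have "a (Suc q * m + r) \<le> a m * a (q * m + r)"
    using assms(2)[of m "q * m + r"] by (simp add: add.assoc)
  also have "\<dots> \<le> a m * (a m ^ q * a r)"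
    by (intro mult_left_mono Suc assms)
  finally show ?case by (simp add: mult.assoc)
qed simp

text \<open>Fekete's lemma in multiplicative form. If some \<open>a m\<close> with \<open>m \<ge> 1\<close> is at most \<open>x ^ m\<close>, then
division with remainder by \<open>m\<close> gives \<open>a n \<le> K * x ^ n\<close> for all \<open>n\<close>, where \<open>K\<close> absorbs the finitely
many remainders, and the root of \<open>K\<close> disappears in the limit. The argument avoids
logarithms, so the sequence may vanish somewhere.\<close>

lemma submultiplicative_root_tendsto_INF:
  fixes a :: "nat \<Rightarrow> real"
  assumes nonneg: "\<And>n. a n \<ge> 0" and submult: "\<And>m n. a (m + n) \<le> a m * a n"
  shows "(\<lambda>n. root n (a n)) \<longlonglongrightarrow> (INF n\<in>{1..}. root n (a n))"
proof -
  define L where "L = (INF n\<in>{1..}. root n (a n))"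
  have bdd: "bdd_below ((\<lambda>n. root n (a n)) ` {1..})"
    by (rule bdd_belowI2[of _ 0]) (simp add: nonneg)
  have lower: "L \<le> root n (a n)" if "n \<ge> 1" for n
    unfolding L_def using that by (intro cINF_lower bdd) auto
  have L0: "L \<ge> 0"
    unfolding L_def by (intro cINF_greatest) (auto simp: nonneg)
  have upper: "\<forall>\<^sub>F n in sequentially. root n (a n) < c" if "L < c" for c
  proof -
    \<comment> \<open>The room between \<open>x\<close> and \<open>c\<close> is what absorbs the factor \<open>root n K\<close>.\<close>
    define x where "x = (L + c) / 2"
    have x: "L < x" "x < c" "x > 0" using that L0 by (auto simp: x_def)
    obtain m where m: "m \<ge> 1" "root m (a m) < x"
      using x(1) bdd unfolding L_def by (subst (asm) cINF_less_iff) auto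
    have am: "a m \<le> x ^ m"
    proof -
      have "a m = root m (a m) ^ m"
        using m nonneg[of m] by simp
      also have "\<dots> \<le> x ^ m"
        using m nonneg[of m] by (intro power_mono) auto
      finally show ?thesis .
    qed
    \<comment> \<open>The summand 1 makes \<open>K\<close> positive, which its \<open>n\<close>-th roots need in order to tend to 1.\<close>
    define K where "K = (MAX r\<in>{..<m}. a r / x ^ r) + 1"
    have K: "a r \<le> K * x ^ r" if "r < m" for r
    proof -
      have "a r / x ^ r \<le> (MAX r\<in>{..<m}. a r / x ^ r)"
        using that by (intro Max_ge) auto
      then have "a r / x ^ r \<le> K" by (simp add: K_def)
      then show ?thesis using x by (simp add: divide_le_eq)
    qed
    have "a 0 / x ^ 0 \<le> (MAX r\<in>{..<m}. a r / x ^ r)"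
      using m by (intro Max_ge image_eqI[of _ _ 0]) auto
    then have K_pos: "K > 0"
      using nonneg[of 0] by (simp add: K_def)
    have bound: "a n \<le> K * x ^ n" for n
    proof -
      have "a n = a (n div m * m + n mod m)" by simp
      also have "\<dots> \<le> a m ^ (n div m) * a (n mod m)"
        by (rule submultiplicative_power_le[OF nonneg submult])
      also have "\<dots> \<le> (x ^ m) ^ (n div m) * (K * x ^ (n mod m))"
        using m x K_pos by (intro mult_mono power_mono am K nonneg) auto
      also have "\<dots> = K * x ^ (m * (n div m) + n mod m)"
        unfolding power_add power_mult by (rule mult.left_commute)
      finally show ?thesis by simp
    qed
    have "(\<lambda>n. root n K * x) \<longlonglongrightarrow> 1 * x"
      by (intro tendsto_intros LIMSEQ_root_const K_pos)
    then have "\<forall>\<^sub>F n in sequentially. root n K * x < c"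
      using x by (intro order_tendstoD) auto
    then show ?thesis
      using eventually_gt_at_top[of 0]
    proof eventually_elim
      case (elim n)
      have "root n (a n) \<le> root n (K * x ^ n)"
        using elim bound by (intro real_root_le_mono) auto
      also have "\<dots> = root n K * x"
        using elim x by (simp add: real_root_mult real_root_power_cancel)
      finally show ?case using elim by simp
    qed
  qed
  show ?thesis
    unfolding L_def[symmetric]
  proof (rule order_tendstoI)
    fix c assume "c < L"
    then show "\<forall>\<^sub>F n in sequentially. c < root n (a n)"
      by (intro eventually_mono[OF eventually_ge_at_top[of 1]]) (use lower in force)
  qed (rule upper)
qed

section \<open>Moments of matrix products and their growth rate\<close>

locale GL_distribution = prob_space \<mu> for \<mu> :: "(real^'n^'n) measure" +
  assumes sets_eq [measurable_cong]: "sets \<mu> = sets GL_borel"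
begin

lemma space_eq: "space \<mu> = GL"
  using sets_eq_imp_space_eq[OF sets_eq] by simp

lemma GL_distribution_mult_convolution:
  assumes "GL_distribution \<nu>"
  shows "GL_distribution (mult_convolution \<mu> \<nu>)"
proof -
  interpret \<nu>: GL_distribution \<nu> by fact
  interpret P: pair_prob_space \<mu> \<nu> ..
  have "prob_space (mult_convolution \<mu> \<nu>)"
    unfolding mult_convolution_def by (intro P.prob_space_distr) measurable
  then show ?thesis
    by (auto simp: GL_distribution_def GL_distribution_axioms_def mult_convolution_def)
qed

lemma nn_integral_mult_convolution:
  assumes "GL_distribution \<nu>" and [measurable]: "f \<in> borel_measurable GL_borel"
  shows "(\<integral>\<^sup>+x. f x \<partial>mult_convolution \<mu> \<nu>) = (\<integral>\<^sup>+g. \<integral>\<^sup>+h. f (g ** h) \<partial>\<nu> \<partial>\<mu>)"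
proof -
  interpret \<nu>: GL_distribution \<nu> by fact
  have "(\<integral>\<^sup>+x. f x \<partial>mult_convolution \<mu> \<nu>) = (\<integral>\<^sup>+p. f ((\<lambda>(g, h). g ** h) p) \<partial>(\<mu> \<Otimes>\<^sub>M \<nu>))"
    unfolding mult_convolution_def by (subst nn_integral_distr) measurable
  also have "\<dots> = (\<integral>\<^sup>+g. \<integral>\<^sup>+h. f (g ** h) \<partial>\<nu> \<partial>\<mu>)"
    by (subst \<nu>.nn_integral_fst[symmetric]) (auto simp: case_prod_beta)
  finally show ?thesis .
qed

lemma GL_distribution_conv_power: "GL_distribution (conv_power \<mu> n)"
proof (induction n)
  case 0
  have "prob_space (return GL_borel (mat 1))"
    by (rule prob_space_return) (simp add: mat_1_in_GL)
  then show ?case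
    by (auto simp: GL_distribution_def GL_distribution_axioms_def)
qed (simp add: GL_distribution_mult_convolution)

lemma sets_conv_power [measurable_cong, simp]: "sets (conv_power \<mu> n) = sets GL_borel"
  using GL_distribution_conv_power[of n]
  by (simp add: GL_distribution_def GL_distribution_axioms_def)

lemma space_conv_power [simp]: "space (conv_power \<mu> n) = GL"
  using sets_eq_imp_space_eq[OF sets_conv_power] by simp

lemma nn_integral_conv_power_0:
  "f \<in> borel_measurable GL_borel \<Longrightarrow> (\<integral>\<^sup>+x. f x \<partial>conv_power \<mu> 0) = f (mat 1)"
  by (simp add: nn_integral_return mat_1_in_GL)

text \<open>Associativity of the convolution, in the form needed for moments: a product of \<open>m + n\<close> independent
factors splits into two independent products.\<close>

lemma nn_integral_conv_power_add:
  assumes "f \<in> borel_measurable GL_borel"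
  shows "(\<integral>\<^sup>+x. f x \<partial>conv_power \<mu> (m + n)) =
    (\<integral>\<^sup>+g. \<integral>\<^sup>+h. f (g ** h) \<partial>conv_power \<mu> n \<partial>conv_power \<mu> m)"
  using assms
proof (induction m arbitrary: f)
  case 0
  note [measurable] = 0
  interpret N: GL_distribution "conv_power \<mu> n" by (rule GL_distribution_conv_power)
  have [measurable]: "(\<lambda>g. \<integral>\<^sup>+h. f (g ** h) \<partial>conv_power \<mu> n) \<in> borel_measurable GL_borel"
    by (intro N.borel_measurable_nn_integral) measurable
  show ?case by (subst nn_integral_conv_power_0) auto
next
  case (Suc m)
  note [measurable] = Suc.prems
  interpret N: GL_distribution "conv_power \<mu> n" by (rule GL_distribution_conv_power)
  have [measurable]: "(\<lambda>g. \<integral>\<^sup>+h. f (g ** h) \<partial>conv_power \<mu> n) \<in> borel_measurable GL_borel"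
    by (intro N.borel_measurable_nn_integral) measurable
  have "(\<integral>\<^sup>+x. f x \<partial>conv_power \<mu> (Suc m + n)) =
      (\<integral>\<^sup>+g. \<integral>\<^sup>+x. f (g ** x) \<partial>conv_power \<mu> (m + n) \<partial>\<mu>)"
    by (simp add: nn_integral_mult_convolution GL_distribution_conv_power)
  also have "\<dots> = (\<integral>\<^sup>+g. \<integral>\<^sup>+x. \<integral>\<^sup>+h. f (g ** (x ** h)) \<partial>conv_power \<mu> n \<partial>conv_power \<mu> m \<partial>\<mu>)"
  proof (rule nn_integral_cong)
    fix g assume "g \<in> space \<mu>"
    then have [measurable]: "(\<lambda>x. g) \<in> GL_borel \<rightarrow>\<^sub>M GL_borel" by (simp add: space_eq)
    show "(\<integral>\<^sup>+x. f (g ** x) \<partial>conv_power \<mu> (m + n)) =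
        (\<integral>\<^sup>+x. \<integral>\<^sup>+h. f (g ** (x ** h)) \<partial>conv_power \<mu> n \<partial>conv_power \<mu> m)"
      by (rule Suc.IH) measurable
  qed
  also have "\<dots> = (\<integral>\<^sup>+x. \<integral>\<^sup>+h. f (x ** h) \<partial>conv_power \<mu> n \<partial>conv_power \<mu> (Suc m))"
    by (simp add: nn_integral_mult_convolution GL_distribution_conv_power matrix_mul_assoc)
  finally show ?case .
qed

text \<open>The moments take values in \<^typ>\<open>ennreal\<close> so that they can be compared before they are known to be
finite.\<close>

definition moment :: "real \<Rightarrow> nat \<Rightarrow> ennreal" where
  "moment s n = (\<integral>\<^sup>+g. ennreal (l1_opnorm g powr s) \<partial>conv_power \<mu> n)"

lemma l1_opnorm_powr_measurable [measurable]:
  "(\<lambda>g. l1_opnorm g powr s :: real) \<in> borel_measurable GL_borel"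
  by (rule borel_measurable_GL_borel) measurable

lemma moment_add_le: "moment s (m + n) \<le> moment s m * moment s n" if "s \<ge> 0"
proof -
  have "moment s (m + n) =
      (\<integral>\<^sup>+g. \<integral>\<^sup>+h. ennreal (l1_opnorm (g ** h) powr s) \<partial>conv_power \<mu> n \<partial>conv_power \<mu> m)"
    unfolding moment_def by (rule nn_integral_conv_power_add) measurable
  also have "\<dots> \<le> (\<integral>\<^sup>+g. \<integral>\<^sup>+h. ennreal (l1_opnorm g powr s) * ennreal (l1_opnorm h powr s)
      \<partial>conv_power \<mu> n \<partial>conv_power \<mu> m)"
  proof (intro nn_integral_mono)
    fix g h :: "real^'n^'n"
    have "l1_opnorm (g ** h) powr s \<le> (l1_opnorm g * l1_opnorm h) powr s"
      using that by (intro powr_mono2 l1_opnorm_mult_le l1_opnorm_nonneg)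
    then show "ennreal (l1_opnorm (g ** h) powr s) \<le>
        ennreal (l1_opnorm g powr s) * ennreal (l1_opnorm h powr s)"
      by (simp add: powr_mult l1_opnorm_nonneg ennreal_mult[symmetric] ennreal_leI)
  qed
  also have "\<dots> = moment s m * moment s n"
    unfolding moment_def by (simp add: nn_integral_cmult nn_integral_multc)
  finally show ?thesis .
qed

lemma moment_0: "moment s 0 = ennreal (l1_opnorm (mat 1 :: real^'n^'n) powr s)"
  unfolding moment_def by (rule nn_integral_conv_power_0) measurable

lemma moment_1: "moment s 1 = (\<integral>\<^sup>+g. ennreal (l1_opnorm g powr s) \<partial>\<mu>)"
proof -
  have "moment s 1 = (\<integral>\<^sup>+g. \<integral>\<^sup>+h. ennreal (l1_opnorm (g ** h) powr s) \<partial>conv_power \<mu> 0 \<partial>\<mu>)"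
    unfolding moment_def One_nat_def conv_power.simps(2)
    by (rule nn_integral_mult_convolution[OF GL_distribution_conv_power]) measurable
  also have "\<dots> = (\<integral>\<^sup>+g. ennreal (l1_opnorm g powr s) \<partial>\<mu>)"
  proof (rule nn_integral_cong)
    fix g assume "g \<in> space \<mu>"
    then have [measurable]: "(\<lambda>x. g) \<in> GL_borel \<rightarrow>\<^sub>M GL_borel" by (simp add: space_eq)
    have "(\<integral>\<^sup>+h. ennreal (l1_opnorm (g ** h) powr s) \<partial>conv_power \<mu> 0)
        = ennreal (l1_opnorm (g ** mat 1) powr s)"
      by (rule nn_integral_conv_power_0) measurable
    then show "(\<integral>\<^sup>+h. ennreal (l1_opnorm (g ** h) powr s) \<partial>conv_power \<mu> 0)
        = ennreal (l1_opnorm g powr s)" by simp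
  qed
  finally show ?thesis .
qed

lemma moment_finite:
  assumes "s \<ge> 0" "moment s 1 < \<infinity>"
  shows "moment s n < \<infinity>"
proof (induction n)
  case 0
  show ?case by (simp add: moment_0)
next
  case (Suc n)
  have "moment s (Suc n) \<le> moment s 1 * moment s n"
    using moment_add_le[OF assms(1), of 1 n] by simp
  also have "\<dots> < \<infinity>"
    using Suc assms(2) by (simp add: ennreal_mult_less_top)
  finally show ?case .
qed

lemma integral_conv_power_eq_moment:
  "(\<integral>g. l1_opnorm g powr s \<partial>conv_power \<mu> n) = enn2real (moment s n)"
  unfolding moment_def by (rule integral_eq_nn_integral) auto

text \<open>\<^const>\<open>k_fun\<close> is a \<^const>\<open>lim\<close>, which is a junk value for divergent sequences; Fekete's lemma shows
that the limit exists.\<close>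

lemma k_fun_limit:
  assumes "s \<ge> 0" "moment s 1 < \<infinity>"
  shows "(\<lambda>n. root n (enn2real (moment s n))) \<longlonglongrightarrow> k_fun \<mu> s"
proof -
  have "enn2real (moment s (m + n)) \<le> enn2real (moment s m) * enn2real (moment s n)" for m n
    unfolding enn2real_mult[symmetric]
    using moment_finite[OF assms]
    by (intro enn2real_mono moment_add_le assms) (simp add: ennreal_mult_less_top)
  from submultiplicative_root_tendsto_INF[OF _ this] show ?thesis
    unfolding k_fun_def integral_conv_power_eq_moment by (simp add: limI)
qed

lemma k_fun_0: "k_fun \<mu> 0 = 1"
proof -
  have moment_eq: "moment 0 n = 1" for n
  proof -
    interpret N: GL_distribution "conv_power \<mu> n" by (rule GL_distribution_conv_power)
    have "moment 0 n = (\<integral>\<^sup>+g. 1 \<partial>conv_power \<mu> n)"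
      unfolding moment_def
    proof (rule nn_integral_cong)
      fix g assume "g \<in> space (conv_power \<mu> n)"
      then have "l1_opnorm g > 0"
        by (simp add: l1_opnorm_pos)
      then show "ennreal (l1_opnorm g powr 0) = 1"
        by simp
    qed
    then show ?thesis using N.emeasure_space_1 by simp
  qed
  have "(\<lambda>n. root n (enn2real (moment 0 n))) \<longlonglongrightarrow> 1"
    using LIMSEQ_root_const[of 1] by (simp add: moment_eq)
  moreover have "(\<lambda>n. root n (enn2real (moment 0 n))) \<longlonglongrightarrow> k_fun \<mu> 0"
    by (rule k_fun_limit) (simp_all add: moment_eq)
  ultimately show ?thesis
    by (blast intro: LIMSEQ_unique)
qed

lemma det_powr_measurable [measurable]:
  "(\<lambda>g::real^'n^'n. \<bar>det g\<bar> powr t) \<in> borel_measurable GL_borel"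
  by (rule borel_measurable_GL_borel) measurable

text \<open>Unlike the moments of the norm, those of the determinant are exactly multiplicative.\<close>

lemma nn_integral_det_powr_conv_power:
  "(\<integral>\<^sup>+g. ennreal (\<bar>det g\<bar> powr t) \<partial>conv_power \<mu> n) = (\<integral>\<^sup>+g. ennreal (\<bar>det g\<bar> powr t) \<partial>\<mu>) ^ n"
proof (induction n)
  case 0
  have "(\<integral>\<^sup>+g. ennreal (\<bar>det g\<bar> powr t) \<partial>conv_power \<mu> 0) = ennreal (\<bar>det (mat 1 :: real^'n^'n)\<bar> powr t)"
    by (rule nn_integral_conv_power_0) measurable
  then show ?case by simp
next
  case (Suc n)
  have "(\<integral>\<^sup>+g. ennreal (\<bar>det g\<bar> powr t) \<partial>conv_power \<mu> (Suc n)) =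
      (\<integral>\<^sup>+g. \<integral>\<^sup>+h. ennreal (\<bar>det (g ** h)\<bar> powr t) \<partial>conv_power \<mu> n \<partial>\<mu>)"
    unfolding conv_power.simps(2)
    by (rule nn_integral_mult_convolution[OF GL_distribution_conv_power]) measurable
  also have "\<dots> = (\<integral>\<^sup>+g. \<integral>\<^sup>+h. ennreal (\<bar>det g\<bar> powr t) * ennreal (\<bar>det h\<bar> powr t) \<partial>conv_power \<mu> n \<partial>\<mu>)"
    by (simp add: det_mul abs_mult powr_mult ennreal_mult)
  also have "\<dots> = (\<integral>\<^sup>+g. ennreal (\<bar>det g\<bar> powr t) \<partial>\<mu>) * (\<integral>\<^sup>+h. ennreal (\<bar>det h\<bar> powr t) \<partial>conv_power \<mu> n)"
    by (simp add: nn_integral_cmult nn_integral_multc)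
  finally show ?case using Suc by simp
qed

lemma one_le_real_card: "1 \<le> real CARD('n)"
  by (simp add: Suc_le_eq)

lemma det_powr_le_moment:
  assumes "0 \<le> s" "s \<le> 1"
  shows "(\<integral>\<^sup>+g. ennreal (\<bar>det g\<bar> powr (s / CARD('n))) \<partial>conv_power \<mu> n) \<le> fact CARD('n) * moment s n"
proof -
  let ?d = "CARD('n)" and ?t = "s / CARD('n)"
  have t: "0 \<le> ?t" "?t \<le> 1"
    using assms order_trans[OF _ one_le_real_card] by (simp_all add: divide_le_eq)
  have "\<bar>det g\<bar> powr ?t \<le> fact ?d * l1_opnorm g powr s" if "g \<in> GL" for g :: "real^'n^'n"
  proof -
    have "\<bar>det g\<bar> powr ?t \<le> (fact ?d * l1_opnorm g ^ ?d) powr ?t"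
      using t by (intro powr_mono2 abs_det_le) auto
    also have "l1_opnorm g ^ ?d = l1_opnorm g powr ?d"
      using l1_opnorm_pos[OF that] by (rule powr_realpow[symmetric])
    also have "(fact ?d * l1_opnorm g powr ?d) powr ?t = fact ?d powr ?t * l1_opnorm g powr s"
      by (simp add: powr_mult powr_powr)
    also have "\<dots> \<le> fact ?d * l1_opnorm g powr s"
      using t powr_mono[of ?t 1 "fact ?d"] by (intro mult_right_mono) (auto simp: fact_ge_1)
    finally show ?thesis .
  qed
  then have "(\<integral>\<^sup>+g. ennreal (\<bar>det g\<bar> powr ?t) \<partial>conv_power \<mu> n) \<le>
      (\<integral>\<^sup>+g. ennreal (fact ?d) * ennreal (l1_opnorm g powr s) \<partial>conv_power \<mu> n)"
    by (intro nn_integral_mono) (auto simp: ennreal_mult[symmetric] intro!: ennreal_leI)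
  also have "\<dots> = ennreal (fact ?d) * moment s n"
    unfolding moment_def by (rule nn_integral_cmult) measurable
  also have "ennreal (fact ?d) = fact ?d"
    by (metis ennreal_of_nat_eq_real_of_nat of_nat_fact)
  finally show ?thesis .
qed

text \<open>A positive lower bound for \<open>k(s)\<close> that does not depend on \<open>s \<in> [0, 1]\<close>. Truncation at 1 makes
it finite and lets \<open>min 1 x \<le> x powr t\<close> hold for all \<open>t \<in> [0, 1]\<close> at once.\<close>

definition truncated_det_mean :: real where
  "truncated_det_mean = (\<integral>g. min 1 \<bar>det g\<bar> \<partial>\<mu>)"

lemma truncated_det_integrable: "integrable \<mu> (\<lambda>g. min 1 \<bar>det g\<bar>)"
proof (rule integrable_const_bound[of _ 1])
  have "(\<lambda>g::real^'n^'n. min 1 \<bar>det g\<bar>) \<in> borel_measurable GL_borel"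
    by (rule borel_measurable_GL_borel) measurable
  then show "(\<lambda>g. min 1 \<bar>det g\<bar>) \<in> borel_measurable \<mu>" by measurable
qed simp

text \<open>The determinant vanishes nowhere on the general linear group.\<close>

lemma truncated_det_mean_pos: "truncated_det_mean > 0"
proof -
  have "truncated_det_mean \<noteq> 0"
  proof
    assume "truncated_det_mean = 0"
    then have "AE g in \<mu>. min 1 \<bar>det g\<bar> = 0"
      unfolding truncated_det_mean_def
      by (subst (asm) integral_nonneg_eq_0_iff_AE[OF truncated_det_integrable]) auto
    moreover have "AE g in \<mu>. det g \<noteq> 0"
      by (rule AE_I2) (auto simp: space_eq GL_def invertible_det_nz)
    ultimately have "AE g in \<mu>. False"
      by eventually_elim (auto simp: min_def split: if_splits)
    then show False by simp
  qed
  moreover have "truncated_det_mean \<ge> 0"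
    unfolding truncated_det_mean_def by (rule Bochner_Integration.integral_nonneg) simp
  ultimately show ?thesis by simp
qed

lemma truncated_det_mean_power_le_moment:
  assumes "0 \<le> s" "s \<le> 1"
  shows "ennreal truncated_det_mean ^ n \<le> fact CARD('n) * moment s n"
proof -
  let ?t = "s / CARD('n)"
  have t: "0 \<le> ?t" "?t \<le> 1"
    using assms order_trans[OF _ one_le_real_card] by (simp_all add: divide_le_eq)
  have min_le: "min 1 x \<le> x powr ?t" if "x \<ge> 0" for x :: real
  proof (cases "x \<ge> 1")
    case True
    then show ?thesis using t ge_one_powr_ge_zero[of x ?t] by simp
  next
    case False
    then show ?thesis using that t powr_mono'[of ?t 1 x] by (cases "x = 0") auto
  qed
  have "ennreal truncated_det_mean = (\<integral>\<^sup>+g. ennreal (min 1 \<bar>det g\<bar>) \<partial>\<mu>)"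
    unfolding truncated_det_mean_def
    by (rule nn_integral_eq_integral[OF truncated_det_integrable, symmetric]) simp
  also have "\<dots> \<le> (\<integral>\<^sup>+g. ennreal (\<bar>det g\<bar> powr ?t) \<partial>\<mu>)"
    by (intro nn_integral_mono ennreal_leI min_le) simp
  finally have "ennreal truncated_det_mean ^ n \<le> (\<integral>\<^sup>+g. ennreal (\<bar>det g\<bar> powr ?t) \<partial>\<mu>) ^ n"
    by (rule power_mono) simp
  also have "\<dots> \<le> fact CARD('n) * moment s n"
    unfolding nn_integral_det_powr_conv_power[symmetric] by (rule det_powr_le_moment[OF assms])
  finally show ?thesis .
qed

text \<open>The moment of order \<open>s\<close> of an \<open>n\<close>-fold product is at least \<open>truncated_det_mean ^ n / d!\<close>; the
\<open>n\<close>-th root of the constant \<open>d!\<close> tends to 1.\<close>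

lemma truncated_det_mean_le_k_fun:
  assumes "0 \<le> s" "s \<le> 1" and fin: "moment s 1 < \<infinity>"
  shows "truncated_det_mean \<le> k_fun \<mu> s"
proof (rule LIMSEQ_le)
  let ?c = truncated_det_mean and ?d = "CARD('n)"
  show "(\<lambda>n. root n (enn2real (moment s n))) \<longlonglongrightarrow> k_fun \<mu> s"
    by (rule k_fun_limit) fact+
  have "(\<lambda>n. root n (1 / fact ?d) * ?c) \<longlonglongrightarrow> 1 * ?c"
    by (intro tendsto_intros LIMSEQ_root_const) simp
  then show "(\<lambda>n. root n (1 / fact ?d) * ?c) \<longlonglongrightarrow> ?c" by simp
  have "root n (1 / fact ?d) * ?c \<le> root n (enn2real (moment s n))" if "n \<ge> 1" for n
  proof -
    have m: "moment s n = ennreal (enn2real (moment s n))"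
      using moment_finite[of s n] assms by simp
    have "ennreal (?c ^ n) \<le> ennreal (fact ?d * enn2real (moment s n))"
      using truncated_det_mean_power_le_moment[OF assms(1,2), of n] truncated_det_mean_pos
      by (subst (asm) m) (simp add: ennreal_power ennreal_mult flip: ennreal_fact)
    then have "?c ^ n \<le> fact ?d * enn2real (moment s n)"
      by (subst (asm) ennreal_le_iff) auto
    then have "1 / fact ?d * ?c ^ n \<le> enn2real (moment s n)"
      by (simp add: divide_le_eq mult.commute)
    then have "root n (1 / fact ?d * ?c ^ n) \<le> root n (enn2real (moment s n))"
      using that by (intro real_root_le_mono) auto
    moreover have "root n (1 / fact ?d * ?c ^ n) = root n (1 / fact ?d) * ?c"
      using that truncated_det_mean_pos unfolding real_root_mult
      by (simp add: real_root_power_cancel)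
    ultimately show ?thesis by simp
  qed
  then show "\<exists>N. \<forall>n\<ge>N. root n (1 / fact ?d) * ?c \<le> root n (enn2real (moment s n))"
    by blast
qed

end

section \<open>The law of a product of independent matrices\<close>

lemma measurable_fold_mult_PiM:
  assumes "set as \<subseteq> A"
  shows "(\<lambda>f. fold (\<lambda>a P. f a ** P) as (mat 1 :: real^'n^'n)) \<in> (\<Pi>\<^sub>M a\<in>A. GL_borel) \<rightarrow>\<^sub>M GL_borel"
  using assms
proof (induction as rule: rev_induct)
  case Nil
  then show ?case by (simp add: mat_1_in_GL)
next
  case (snoc a as)
  then have [measurable]: "(\<lambda>f. fold (\<lambda>a P. f a ** P) as (mat 1 :: real^'n^'n)) \<in> (\<Pi>\<^sub>M a\<in>A. GL_borel) \<rightarrow>\<^sub>M GL_borel"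
    and [measurable]: "a \<in> A" by auto
  show ?case by simp
qed

text \<open>Induction on the list from its end: the new factor is independent of the product of the previous ones,
because these involve other indices. It multiplies from the left, which is also the side on which
\<^const>\<open>conv_power\<close> grows.\<close>

lemma (in prob_space) distr_fold_mult:
  fixes \<xi> :: "'b \<Rightarrow> 'a \<Rightarrow> real^'n^'n"
  assumes indep: "indep_vars (\<lambda>_. GL_borel) \<xi> I"
    and law: "\<And>a. a \<in> I \<Longrightarrow> distr M GL_borel (\<xi> a) = \<mu>"
    and as: "distinct as" "set as \<subseteq> I"
  shows "random_variable GL_borel (\<lambda>\<omega>. fold (\<lambda>a P. \<xi> a \<omega> ** P) as (mat 1))"
    and "distr M GL_borel (\<lambda>\<omega>. fold (\<lambda>a P. \<xi> a \<omega> ** P) as (mat 1)) = conv_power \<mu> (length as)"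
proof -
  have rv: "random_variable GL_borel (\<xi> a)" if "a \<in> I" for a
    using indep that by (simp add: indep_vars_def)
  have "random_variable GL_borel (\<lambda>\<omega>. fold (\<lambda>a P. \<xi> a \<omega> ** P) as (mat 1)) \<and>
    distr M GL_borel (\<lambda>\<omega>. fold (\<lambda>a P. \<xi> a \<omega> ** P) as (mat 1)) = conv_power \<mu> (length as)"
    using as
  proof (induction as rule: rev_induct)
    case Nil
    have "distr M GL_borel (\<lambda>\<omega>. mat 1 :: real^'n^'n) = return GL_borel (mat 1)"
    proof (rule measure_eqI)
      fix A :: "(real^'n^'n) set" assume "A \<in> sets (distr M GL_borel (\<lambda>\<omega>. mat 1))"
      then show "emeasure (distr M GL_borel (\<lambda>\<omega>. mat 1)) A = emeasure (return GL_borel (mat 1)) A"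
        by (auto simp: emeasure_distr mat_1_in_GL emeasure_space_1 indicator_def)
    qed simp
    then show ?case by (simp add: mat_1_in_GL)
  next
    case (snoc a as)
    let ?P = "\<lambda>\<omega>. fold (\<lambda>a P. \<xi> a \<omega> ** P) as (mat 1)"
    have [measurable]: "random_variable GL_borel ?P"
      and P: "distr M GL_borel ?P = conv_power \<mu> (length as)"
      using snoc by auto
    have [measurable]: "random_variable GL_borel (\<xi> a)" and a: "distr M GL_borel (\<xi> a) = \<mu>"
      using snoc rv law by auto
    have "indep_var GL_borel ((\<lambda>f. f a) \<circ> (\<lambda>\<omega>. restrict (\<lambda>i. \<xi> i \<omega>) {a}))
        GL_borel ((\<lambda>f. fold (\<lambda>a P. f a ** P) as (mat 1)) \<circ> (\<lambda>\<omega>. restrict (\<lambda>i. \<xi> i \<omega>) (set as)))"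
      using snoc.prems
      by (intro indep_var_compose[OF indep_var_restrict[OF indep]] measurable_fold_mult_PiM) auto
    also have "(\<lambda>f. f a) \<circ> (\<lambda>\<omega>. restrict (\<lambda>i. \<xi> i \<omega>) {a}) = \<xi> a"
      by auto
    also have "(\<lambda>f. fold (\<lambda>a P. f a ** P) as (mat 1)) \<circ> (\<lambda>\<omega>. restrict (\<lambda>i. \<xi> i \<omega>) (set as)) = ?P"
      by (auto simp: comp_def intro!: ext fold_cong)
    finally have "indep_var GL_borel (\<xi> a) GL_borel ?P" .
    then have joint: "\<mu> \<Otimes>\<^sub>M conv_power \<mu> (length as) =
        distr M (GL_borel \<Otimes>\<^sub>M GL_borel) (\<lambda>\<omega>. (\<xi> a \<omega>, ?P \<omega>))"
      unfolding indep_var_distribution_eq a P by (elim conjE)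
    have "conv_power \<mu> (Suc (length as)) =
        distr (distr M (GL_borel \<Otimes>\<^sub>M GL_borel) (\<lambda>\<omega>. (\<xi> a \<omega>, ?P \<omega>))) GL_borel (\<lambda>(g, h). g ** h)"
      unfolding conv_power.simps mult_convolution_def joint ..
    also have "\<dots> = distr M GL_borel (\<lambda>\<omega>. \<xi> a \<omega> ** ?P \<omega>)"
      by (subst distr_distr) (auto simp: comp_def)
    finally show ?case by simp
  qed
  then show "random_variable GL_borel (\<lambda>\<omega>. fold (\<lambda>a P. \<xi> a \<omega> ** P) as (mat 1))"
    and "distr M GL_borel (\<lambda>\<omega>. fold (\<lambda>a P. \<xi> a \<omega> ** P) as (mat 1)) = conv_power \<mu> (length as)"
    by auto
qed

section \<open>Levels and paths of the tree\<close>

lemma take_in_tree_level: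
  assumes "v \<in> tree_level B n" "m \<le> n"
  shows "take m v \<in> tree_level B m"
  using assms by (auto simp: tree_level_def min_def)

lemma finite_tree_level: "finite (tree_level B n)"
proof (induction n)
  case 0
  have "tree_level B 0 \<subseteq> {[]}" by (auto simp: tree_level_def)
  then show ?case by (rule finite_subset) simp
next
  case (Suc n)
  have "tree_level B (Suc n) \<subseteq> (\<Union>v\<in>tree_level B n. (\<lambda>x. v @ [x]) ` {1..B v})"
  proof
    fix v assume v: "v \<in> tree_level B (Suc n)"
    then have len: "length v = Suc n" and last: "v ! n \<in> {1..B (take n v)}"
      by (auto simp: tree_level_def)
    have v_eq: "v = take n v @ [v ! n]"
      using take_Suc_conv_app_nth[of n v] len by simp
    show "v \<in> (\<Union>v\<in>tree_level B n. (\<lambda>x. v @ [x]) ` {1..B v})"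
    proof (rule UN_I)
      show "take n v \<in> tree_level B n"
        using take_in_tree_level[OF v, of n] by simp
      show "v \<in> (\<lambda>x. take n v @ [x]) ` {1..B (take n v)}"
        by (rule image_eqI[where x = "v ! n"]) (fact v_eq, fact last)
    qed
  qed
  then show ?case by (rule finite_subset) (simp add: Suc)
qed

lemma tree_level_nonempty:
  assumes "without_extinction B"
  shows "tree_level B n \<noteq> {}"
proof -
  obtain w where "map w [0..<n] \<in> tree_vertices B"
    using assms by (auto simp: without_extinction_def tree_boundary_def)
  then obtain m where m: "map w [0..<n] \<in> tree_level B m"
    by (auto simp: tree_vertices_def)
  moreover from m have "m = n" by (auto simp: tree_level_def)
  ultimately show ?thesis by auto
qed

text \<open>An infinite word in the boundary contributes a vertex to every level.\<close>

lemma upper_growth_rate_ge_1: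
  assumes "without_extinction B"
  shows "upper_growth_rate B \<ge> 1"
  unfolding upper_growth_rate_def
proof (rule le_Limsup)
  have "1 \<le> ereal (root n (real (card (tree_level B n))))" if "n \<ge> 1" for n
  proof -
    have "card (tree_level B n) \<ge> 1"
      using tree_level_nonempty[OF assms, of n] finite_tree_level[of B n] by (simp add: Suc_le_eq card_gt_0_iff)
    then show ?thesis using that by simp
  qed
  then show "\<forall>\<^sub>F n in sequentially. 1 \<le> ereal (root n (real (card (tree_level B n))))"
    using eventually_sequentially by blast
qed simp

lemma path_edges_in_tree:
  assumes "v \<in> tree_level B n"
  shows "distinct (path_edges v)" "set (path_edges v) \<subseteq> tree_edges B" "length (path_edges v) = n"
proof -
  have len: "length v = n" using assms by (simp add: tree_level_def)
  show "length (path_edges v) = n" by (simp add: path_edges_def len)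
  have "inj_on (\<lambda>l. (take l v, take (Suc l) v)) {0..<length v}"
  proof (rule inj_onI)
    fix k l assume "k \<in> {0..<length v}" "l \<in> {0..<length v}"
      and "(take k v, take (Suc k) v) = (take l v, take (Suc l) v)"
    then have "length (take k v) = length (take l v)" "k < length v" "l < length v" by auto
    then show "k = l" by simp
  qed
  then show "distinct (path_edges v)"
    by (simp add: path_edges_def distinct_map)
  show "set (path_edges v) \<subseteq> tree_edges B"
  proof
    fix a assume "a \<in> set (path_edges v)"
    then obtain l where l: "l < n" "a = (take l v, take (Suc l) v)"
      by (auto simp: path_edges_def len)
    have "take (Suc l) v \<in> tree_vertices B"
      using take_in_tree_level[OF assms, of "Suc l"] l by (auto simp: tree_vertices_def)
    moreover have "butlast (take (Suc l) v) = take l v"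
      using l len by (simp add: butlast_take)
    moreover have "take (Suc l) v \<noteq> []" using l len by auto
    ultimately show "a \<in> tree_edges B"
      unfolding tree_edges_def l(2) by force
  qed
qed

section \<open>Summability\<close>

text \<open>The root test. Positivity of the limit \<open>k\<close> matters because the limit superior of a product
need not be the product when one factor tends to 0 and the other is unbounded.\<close>

lemma summable_mult_if_growth:
  fixes x y :: "nat \<Rightarrow> real"
  assumes nonneg: "\<And>n. x n \<ge> 0" "\<And>n. y n \<ge> 0"
    and lim: "(\<lambda>n. root n (y n)) \<longlonglongrightarrow> k" and "k > 0"
    and less: "ereal k * limsup (\<lambda>n. ereal (root n (x n))) < 1"
  shows "summable (\<lambda>n. x n * y n)"
proof (rule root_test_convergence')
  have "limsup (\<lambda>n. ereal (root n (norm (x n * y n)))) =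
      limsup (\<lambda>n. ereal (root n (y n)) * ereal (root n (x n)))"
    using nonneg by (simp add: real_root_mult mult.commute abs_mult)
  also have "\<dots> = ereal k * limsup (\<lambda>n. ereal (root n (x n)))"
    using lim \<open>k > 0\<close> by (intro ereal_limsup_lim_mult) auto
  finally show "limsup (\<lambda>n. ereal (root n (norm (x n * y n)))) < 1"
    using less by simp
qed

text \<open>By Tonelli the expectation of the whole series is \<open>\<Sum>n. card (V n) * a n\<close>, and a finite expectation
rules out the value \<open>\<infinity>\<close> almost surely.\<close>

lemma (in prob_space) AE_summable_if_mean_summable:
  fixes f :: "nat \<Rightarrow> 'b \<Rightarrow> 'a \<Rightarrow> real"
  assumes nonneg: "\<And>n v \<omega>. f n v \<omega> \<ge> 0"
    and meas: "\<And>n v. v \<in> V n \<Longrightarrow> f n v \<in> borel_measurable M"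
    and mean: "\<And>n v. v \<in> V n \<Longrightarrow> (\<integral>\<^sup>+\<omega>. ennreal (f n v \<omega>) \<partial>M) = ennreal (a n)"
    and a: "\<And>n. a n \<ge> 0" "summable (\<lambda>n. real (card (V n)) * a n)"
  shows "AE \<omega> in M. summable (\<lambda>n. \<Sum>v\<in>V n. f n v \<omega>)"
proof -
  note [measurable] = meas
  have [measurable]: "(\<lambda>\<omega>. \<Sum>v\<in>V n. f n v \<omega>) \<in> borel_measurable M" for n
    by (intro borel_measurable_sum meas)
  have "(\<integral>\<^sup>+\<omega>. (\<Sum>n. ennreal (\<Sum>v\<in>V n. f n v \<omega>)) \<partial>M) = (\<Sum>n. \<integral>\<^sup>+\<omega>. ennreal (\<Sum>v\<in>V n. f n v \<omega>) \<partial>M)"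
    by (rule nn_integral_suminf) measurable
  also have "\<dots> = (\<Sum>n. ennreal (real (card (V n)) * a n))"
  proof (rule suminf_cong)
    fix n
    have "(\<integral>\<^sup>+\<omega>. ennreal (\<Sum>v\<in>V n. f n v \<omega>) \<partial>M) = (\<integral>\<^sup>+\<omega>. (\<Sum>v\<in>V n. ennreal (f n v \<omega>)) \<partial>M)"
      using nonneg by simp
    also have "\<dots> = (\<Sum>v\<in>V n. \<integral>\<^sup>+\<omega>. ennreal (f n v \<omega>) \<partial>M)"
      using meas by (intro nn_integral_sum) measurable
    also have "\<dots> = ennreal (real (card (V n)) * a n)"
      using a by (simp add: mean ennreal_mult ennreal_of_nat_eq_real_of_nat)
    finally show "(\<integral>\<^sup>+\<omega>. ennreal (\<Sum>v\<in>V n. f n v \<omega>) \<partial>M) = ennreal (real (card (V n)) * a n)" .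
  qed
  also have "\<dots> \<noteq> \<infinity>"
    unfolding infinity_ennreal_def
    by (rule ennreal_suminf_neq_top[OF a(2)]) (intro mult_nonneg_nonneg of_nat_0_le_iff a(1))
  finally have "AE \<omega> in M. (\<Sum>n. ennreal (\<Sum>v\<in>V n. f n v \<omega>)) \<noteq> \<infinity>"
    by (intro nn_integral_noteq_infinite) auto
  then show ?thesis
  proof eventually_elim
    case (elim \<omega>)
    then show ?case
      by (intro summable_suminf_not_top) (auto simp: nonneg sum_nonneg)
  qed
qed

text \<open>The level sums of the \<open>s\<close>-th powers tend to 0, so from some level on every term is at most 1 and
hence at most its own \<open>s\<close>-th power.\<close>

lemma summable_sum_if_summable_sum_powr:
  fixes x :: "nat \<Rightarrow> 'b \<Rightarrow> real"
  assumes s: "0 < s" "s \<le> 1" and nonneg: "\<And>n v. x n v \<ge> 0" and fin: "\<And>n. finite (V n)"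
    and summable: "summable (\<lambda>n. \<Sum>v\<in>V n. x n v powr s)"
  shows "summable (\<lambda>n. \<Sum>v\<in>V n. x n v)"
proof (rule summable_comparison_test_ev[OF _ summable])
  have "(\<lambda>n. \<Sum>v\<in>V n. x n v powr s) \<longlonglongrightarrow> 0"
    by (rule summable_LIMSEQ_zero[OF summable])
  then have "\<forall>\<^sub>F n in sequentially. (\<Sum>v\<in>V n. x n v powr s) < 1"
    by (rule order_tendstoD) simp
  then show "\<forall>\<^sub>F n in sequentially. norm (\<Sum>v\<in>V n. x n v) \<le> (\<Sum>v\<in>V n. x n v powr s)"
  proof eventually_elim
    case (elim n)
    have "x n v \<le> x n v powr s" if v: "v \<in> V n" for v
    proof -
      have "x n v powr s \<le> (\<Sum>v\<in>V n. x n v powr s)"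
        using v fin by (intro member_le_sum) auto
      then have "x n v powr s < 1 powr s" using elim by simp
      then have "x n v \<le> 1"
        using s nonneg[of n v] powr_mono2[of s 1 "x n v"] by linarith
      then show ?thesis
        using s nonneg[of n v] powr_mono'[of s 1 "x n v"] by (cases "x n v = 0") auto
    qed
    then show ?case
      using nonneg by (simp add: sum_nonneg sum_mono)
  qed
qed

text \<open>Absolute convergence of every entry, since the operator norm dominates the entries.\<close>

lemma cascade_zeta_inf_finite:
  assumes "summable (\<lambda>n. \<Sum>v\<in>tree_level B n. l1_opnorm (path_product \<xi> v \<omega>))"
  shows "cascade_zeta_inf B \<xi> i j \<omega> < \<infinity>"
proof -
  have "summable (\<lambda>n. cascade_psi B \<xi> n \<omega> $ i $ j)"
  proof (rule summable_comparison_test'[OF assms])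
    fix n :: nat
    show "norm (cascade_psi B \<xi> n \<omega> $ i $ j) \<le> (\<Sum>v\<in>tree_level B n. l1_opnorm (path_product \<xi> v \<omega>))"
      unfolding cascade_psi_def
      by (auto intro!: order_trans[OF sum_abs] sum_mono abs_entry_le_l1_opnorm)
  qed
  then have "summable (\<lambda>n. cascade_psi B \<xi> (Suc n) \<omega> $ i $ j)"
    using summable_Suc_iff[of "\<lambda>n. cascade_psi B \<xi> n \<omega> $ i $ j"] by blast
  then have "convergent (\<lambda>n. \<Sum>k<n. cascade_psi B \<xi> (Suc k) \<omega> $ i $ j)"
    by (simp add: summable_iff_convergent)
  moreover have "(\<Sum>k<n. cascade_psi B \<xi> (Suc k) \<omega> $ i $ j) = cascade_zeta B \<xi> n \<omega> $ i $ j" for n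
    by (simp add: cascade_zeta_def sum.atLeast1_atMost_eq)
  ultimately obtain l where "(\<lambda>n. cascade_zeta B \<xi> n \<omega> $ i $ j) \<longlonglongrightarrow> l"
    by (auto simp: convergent_def)
  then have "cascade_zeta_inf B \<xi> i j \<omega> = ereal l"
    unfolding cascade_zeta_inf_def by (intro limI tendsto_intros)
  then show ?thesis by simp
qed

text \<open>The bound \<open>c\<close> makes the infimum positive, which forces \<open>G\<close> to be finite: in \<^typ>\<open>ereal\<close> the product
\<open>0 * \<infinity>\<close> is 0 and would satisfy the hypothesis. The exponent 0 is impossible because \<open>k 0 * G = G \<ge> 1\<close>.\<close>

lemma exists_subcritical_exponent:
  fixes k :: "real \<Rightarrow> real" and G :: ereal
  assumes "0 < c" and k: "\<And>s. s \<in> {0..1} \<Longrightarrow> c \<le> k s"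
    and "k 0 = 1" "G \<ge> 1" and less: "ereal (INF s\<in>{0..1}. k s) * G < 1"
  obtains s where "0 < s" "s \<le> 1" "ereal (k s) * G < 1"
proof -
  let ?l = "INF s\<in>{0..1}. k s"
  have "c \<le> ?l"
    by (rule cINF_greatest) (use k in auto)
  then have l: "?l > 0" using \<open>0 < c\<close> by linarith
  have "G \<noteq> \<infinity>" using l less by auto
  then obtain g where g: "G = ereal g" "g \<ge> 1"
    using \<open>G \<ge> 1\<close> by (cases G) auto
  have "?l < 1 / g"
    using less g by (simp add: less_divide_eq one_ereal_def)
  moreover have "bdd_below (k ` {0..1})"
    using k by (intro bdd_belowI2) auto
  ultimately obtain s where s: "s \<in> {0..1}" "k s < 1 / g"
    by (subst (asm) cINF_less_iff) auto
  have "s \<noteq> 0"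
  proof
    assume "s = 0"
    then have "g < 1" using s \<open>k 0 = 1\<close> g by (simp add: less_divide_eq)
    then show False using g by simp
  qed
  then show thesis
    using s g that[of s] by (auto simp: less_divide_eq one_ereal_def)
qed

section \<open>Finiteness of the integrated cascade\<close>

theorem theorem3p1:
  fixes B :: "nat list \<Rightarrow> nat"
    and \<mu> :: "(real^'n^'n) measure"
    and M :: "'w measure"
    and \<xi> :: "nat list \<times> nat list \<Rightarrow> 'w \<Rightarrow> real^'n^'n"
  assumes "without_extinction B"
    and "prob_space \<mu>" and "sets \<mu> = sets GL_borel"
    and "all_moments \<mu>"
    and "strongly_irreducible \<mu>"
    and "strictly_positive \<mu>"
    and "prob_space M"
    and "prob_space.indep_vars M (\<lambda>_. GL_borel) \<xi> (tree_edges B)"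
    and "\<forall>a\<in>tree_edges B. distr M GL_borel (\<xi> a) = \<mu>"
    and "ereal (INF s\<in>{0..1}. k_fun \<mu> s) * upper_growth_rate B < 1"
  shows "AE \<omega> in M. \<forall>i j. cascade_zeta_inf B \<xi> i j \<omega> < \<infinity>"
proof -
  interpret GL_distribution \<mu>
    using assms(2,3) by (simp add: GL_distribution_def GL_distribution_axioms_def)
  interpret M: prob_space M by fact
  have fin: "moment s 1 < \<infinity>" if "s \<ge> 0" for s
    using assms(4) that unfolding moment_1 all_moments_def
    by (subst nn_integral_eq_integral) auto
  obtain s where s: "0 < s" "s \<le> 1" "ereal (k_fun \<mu> s) * upper_growth_rate B < 1"
  proof (rule exists_subcritical_exponent[OF truncated_det_mean_pos])
    show "truncated_det_mean \<le> k_fun \<mu> s" if "s \<in> {0..1}" for s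
      using that fin by (intro truncated_det_mean_le_k_fun) auto
  qed (use assms(1,10) k_fun_0 upper_growth_rate_ge_1 in auto)
  define a where "a n = enn2real (moment s n)" for n
  have a: "moment s n = ennreal (a n)" "a n \<ge> 0" for n
    using moment_finite[OF _ fin, of s n] s by (simp_all add: a_def)
  have "k_fun \<mu> s > 0"
    using truncated_det_mean_pos truncated_det_mean_le_k_fun[OF _ _ fin, of s] s by simp
  moreover have "(\<lambda>n. root n (a n)) \<longlonglongrightarrow> k_fun \<mu> s"
    unfolding a_def using s fin by (intro k_fun_limit) auto
  ultimately have summable: "summable (\<lambda>n. real (card (tree_level B n)) * a n)"
    using s(3) a(2) by (intro summable_mult_if_growth) (auto simp: upper_growth_rate_def)
  have law: "M.random_variable GL_borel (path_product \<xi> v)"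
    "distr M GL_borel (path_product \<xi> v) = conv_power \<mu> n" if "v \<in> tree_level B n" for n v
    using M.distr_fold_mult[OF assms(8) _ path_edges_in_tree(1,2)[OF that], of \<mu>] assms(9)
      path_edges_in_tree(3)[OF that]
    by (auto simp: path_product_def[abs_def])
  have "AE \<omega> in M. summable (\<lambda>n. \<Sum>v\<in>tree_level B n. l1_opnorm (path_product \<xi> v \<omega>) powr s)"
  proof (rule M.AE_summable_if_mean_summable[OF _ _ _ a(2) summable])
    fix n v assume v: "v \<in> tree_level B n"
    note [measurable] = law(1)[OF v]
    show "(\<lambda>\<omega>. l1_opnorm (path_product \<xi> v \<omega>) powr s) \<in> borel_measurable M"
      by measurable
    show "(\<integral>\<^sup>+\<omega>. ennreal (l1_opnorm (path_product \<xi> v \<omega>) powr s) \<partial>M) = ennreal (a n)"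
      unfolding a(1)[symmetric] moment_def law(2)[OF v, symmetric]
      by (rule nn_integral_distr[symmetric]) measurable
  qed simp
  then show ?thesis
  proof eventually_elim
    case (elim \<omega>)
    then have "summable (\<lambda>n. \<Sum>v\<in>tree_level B n. l1_opnorm (path_product \<xi> v \<omega>))"
      by (rule summable_sum_if_summable_sum_powr[OF s(1,2) l1_opnorm_nonneg finite_tree_level])
    then show ?case by (intro allI cascade_zeta_inf_finite)
  qed
qed

end
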